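(* Let $0<\lambda<1$ and $\nu\in\mathrm{Prob}(X)$. There exists at least one $\mu\in\mathcal{H}^\lambda(\nu)$ attaining the supremum $m_\lambda(R)=\sup_{\mu\in\mathcal{H}^\lambda(\nu)}\int A_c(\tau_a(x))\,d\mu(x,c,a)$, so that $m_\lambda(R)=\max_{\mu\in\mathcal{H}^\lambda(\nu)}\int A_c(\tau_a(x))\,d\mu(x,c,a)$. Besides, $$\inf_{w\in C^0(X,\mathbb{R})}\left[(1-\lambda)\int w(x)\,d\nu(x)+\sup_{x\in X,\,c\in\mathcal{C},\,a\in\mathcal{I}}\left\{d_x^\lambda w(a)+A_c(\tau_a(x))\right\}\right]=\max_{\mu\in\mathcal{H}^\lambda(\nu)}\int A_c(\tau_a(x))\,d\mu(x,c,a).$$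
   Context: $(X,d)$ is a compact metric space, $\mathcal{C}$ and $\mathcal{I}$ are finite nonempty sets, $R=(X,\tau_a)_{a\in\mathcal{I}}$ is a contractive IFS (each $\tau_a:X\to X$ is a contraction), and $A_c:X\to\mathbb{R}$, $c\in\mathcal{C}$, are Lipschitz functions. For $w\in C^0(X,\mathbb{R})$ put $d_x^\lambda w(a)=\lambda w(\tau_a(x))-w(x)$. The set of discounted holonomic probabilities with discount $\lambda$ and trace $\nu$ is $$\mathcal{H}^\lambda(\nu)=\left\{\mu\in\mathrm{Prob}(X\times\mathcal{C}\times\mathcal{I}) : \int d_x^\lambda w(a)\,d\mu(x,c,a)=-(1-\lambda)\int w\,d\nu\ \ \forall w\in C^0(X,\mathbb{R})\right\}.$$ *)

theory Defs
  imports "HOL-Probability.Probability"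
begin

definition contractive_IFS ::
    "'x::metric_space set \<Rightarrow> 'i set \<Rightarrow> ('i \<Rightarrow> 'x \<Rightarrow> 'x) \<Rightarrow> bool" where
  "contractive_IFS X I \<tau> \<longleftrightarrow>
     (\<forall>a\<in>I. \<tau> a \<in> X \<rightarrow> X \<and> (\<exists>L<1. L-lipschitz_on X (\<tau> a)))"

text \<open>
  Elements of \<^term>\<open>C0 X\<close> are functions on the whole type; only their values on \<^term>\<open>X\<close>
  are constrained, and only these values are used below.
\<close>
definition C0 :: "'x::metric_space set \<Rightarrow> ('x \<Rightarrow> real) set" where
  "C0 X = {w. continuous_on X w}"

definition borel_on :: "'x::metric_space set \<Rightarrow> 'x measure" where
  "borel_on X = restrict_space borel X"

text \<open>
  The finite sets \<open>C\<close> and \<open>I\<close> are discrete, so this product sigma-algebra is the Borel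
  sigma-algebra of the topological product of \<open>X\<close>, \<open>C\<close> and \<open>I\<close>.
\<close>
definition phase_space ::
    "'x::metric_space set \<Rightarrow> 'c set \<Rightarrow> 'i set \<Rightarrow> ('x \<times> 'c \<times> 'i) measure" where
  "phase_space X C I = borel_on X \<Otimes>\<^sub>M (count_space C \<Otimes>\<^sub>M count_space I)"

definition disc_diff ::
    "('i \<Rightarrow> 'x \<Rightarrow> 'x) \<Rightarrow> real \<Rightarrow> ('x \<Rightarrow> real) \<Rightarrow> 'x \<Rightarrow> 'i \<Rightarrow> real" where
  "disc_diff \<tau> lam w x a = lam * w (\<tau> a x) - w x"

definition disc_holonomic ::
    "'x::metric_space set \<Rightarrow> 'c set \<Rightarrow> 'i set \<Rightarrow> ('i \<Rightarrow> 'x \<Rightarrow> 'x) \<Rightarrow> real \<Rightarrow> 'x measure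
      \<Rightarrow> ('x \<times> 'c \<times> 'i) measure set" where
  "disc_holonomic X C I \<tau> lam \<nu> =
     {\<mu> \<in> space (prob_algebra (phase_space X C I)).
        \<forall>w\<in>C0 X. (\<integral>(x, c, a). disc_diff \<tau> lam w x a \<partial>\<mu>) = - (1 - lam) * (\<integral>x. w x \<partial>\<nu>)}"

definition reward ::
    "('c \<Rightarrow> 'x \<Rightarrow> real) \<Rightarrow> ('i \<Rightarrow> 'x \<Rightarrow> 'x) \<Rightarrow> ('x \<times> 'c \<times> 'i) measure \<Rightarrow> real" where
  "reward A \<tau> \<mu> = (\<integral>(x, c, a). A c (\<tau> a x) \<partial>\<mu>)"

text \<open>
  Suprema and infima are taken in the extended reals, so that finiteness (and nonemptiness of
  the set of holonomic probabilities) is not presupposed.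
\<close>
definition max_value ::
    "'x::metric_space set \<Rightarrow> 'c set \<Rightarrow> 'i set \<Rightarrow> ('i \<Rightarrow> 'x \<Rightarrow> 'x) \<Rightarrow> ('c \<Rightarrow> 'x \<Rightarrow> real) \<Rightarrow> real
      \<Rightarrow> 'x measure \<Rightarrow> ereal" where
  "max_value X C I \<tau> A lam \<nu> = (SUP \<mu>\<in>disc_holonomic X C I \<tau> lam \<nu>. ereal (reward A \<tau> \<mu>))"

end

theory Submission imports Defs begin

text \<open>
  The problem is a discounted Markov decision problem, and dynamic programming constructs optimal
  points of both the primal and the dual problem. A point \<open>x\<close> is a state and a pair
  \<open>(c, a)\<close> is an action, which moves \<open>x\<close> to \<open>\<tau> a x\<close> and pays \<open>A c (\<tau> a x)\<close>.

  Weak duality is immediate: for holonomic \<open>\<mu>\<close> and continuous \<open>w\<close>, adding and subtracting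
  \<open>disc_diff\<close> under the integral bounds the reward of \<open>\<mu>\<close> by the dual value of \<open>w\<close>
  (\<open>reward_le_dual_value\<close>). Hence it suffices to exhibit one \<open>w\<close> and one \<open>\<mu>\<close> for which
  the two values agree; both are then optimal.

  The dual point is the value function, the continuous solution \<open>v\<close> of the Bellman equation
  \<open>v x = Max\<^sub>(\<^sub>c\<^sub>,\<^sub>a\<^sub>) (A c (\<tau> a x) + lam * v (\<tau> a x))\<close> (\<open>bellman_solution\<close>). By this equation
  the supremum in its dual value is at most \<open>0\<close>, so the dual value is at most
  \<open>(1 - lam) * \<integral>x. v x \<partial>\<nu>\<close>.

  The primal point comes from a measurable choice \<open>s x\<close> of a maximizing action
  (\<open>measurable_argmax\<close>). Let \<open>T\<close> be the resulting, in general discontinuous, map on states, and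
  let \<open>\<rho>\<close> be the discounted occupation measure of the \<open>T\<close>-orbit started in \<open>\<nu>\<close>, which is
  characterized by \<open>\<rho> = (1 - lam) \<nu> + lam T\<^sub>* \<rho>\<close> (\<open>discounted_occupation_measure\<close>). Its image
  \<open>\<mu>\<close> on the graph of \<open>s\<close> is holonomic because of that identity; and because \<open>s\<close> attains the
  maximum, its payoff is \<open>v - lam * (v \<circ> T)\<close>, whose \<open>\<rho>\<close>-integral is
  \<open>(1 - lam) * \<integral>x. v x \<partial>\<nu>\<close> by the same identity.
\<close>

section \<open>The discounted Bellman equation\<close>

lemma continuous_on_Max:
  fixes f :: "'p \<Rightarrow> 'a::topological_space \<Rightarrow> 'b::linorder_topology"
  assumes "finite P" "P \<noteq> {}" "\<And>p. p \<in> P \<Longrightarrow> continuous_on X (f p)"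
  shows "continuous_on X (\<lambda>x. Max ((\<lambda>p. f p x) ` P))"
  using assms
proof (induction P rule: finite_ne_induct)
  case (insert p P)
  then show ?case by (auto intro!: continuous_on_max)
qed simp

lemma abs_Max_diff_le:
  fixes f g :: "'p \<Rightarrow> real"
  assumes P: "finite P" "P \<noteq> {}" and close: "\<And>p. p \<in> P \<Longrightarrow> \<bar>f p - g p\<bar> \<le> e"
  shows "\<bar>Max (f ` P) - Max (g ` P)\<bar> \<le> e"
proof -
  have le: "Max (h ` P) \<le> Max (k ` P) + e"
    if "\<And>p. p \<in> P \<Longrightarrow> h p \<le> k p + e" for h k :: "'p \<Rightarrow> real"
    using P by (subst Max_le_iff) (auto intro!: order.trans[OF that] Max_ge)
  have "f p \<le> g p + e" "g p \<le> f p + e" if "p \<in> P" for p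
    using close[OF that] by linarith+
  then have "Max (f ` P) \<le> Max (g ` P) + e" "Max (g ` P) \<le> Max (f ` P) + e"
    by (auto intro!: le)
  then show ?thesis by linarith
qed

text \<open>
  The Bellman operator contracts the uniform distance on \<open>X\<close> by the factor \<open>lam\<close>, since a
  maximum over finitely many actions is nonexpansive. Value iteration started at \<open>0\<close> therefore
  converges uniformly, by the M-test for its telescoping series.
\<close>
lemma bellman_solution:
  fixes X :: "'x::metric_space set" and P :: "'p set"
    and \<sigma> :: "'p \<Rightarrow> 'x \<Rightarrow> 'x" and g :: "'p \<Rightarrow> 'x \<Rightarrow> real"
  assumes "compact X" and P: "finite P" "P \<noteq> {}" and lam: "0 < lam" "lam < 1"
    and g: "\<And>p. p \<in> P \<Longrightarrow> continuous_on X (g p)"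
    and \<sigma>: "\<And>p. p \<in> P \<Longrightarrow> continuous_on X (\<sigma> p)"
    and maps: "\<And>p. p \<in> P \<Longrightarrow> \<sigma> p \<in> X \<rightarrow> X"
  obtains v where "continuous_on X v"
    and "\<And>x. x \<in> X \<Longrightarrow> v x = Max ((\<lambda>p. g p x + lam * v (\<sigma> p x)) ` P)"
proof -
  define B where "B = (\<lambda>v x. Max ((\<lambda>p. g p x + lam * v (\<sigma> p x)) ` P))"
  define u where "u n = (B ^^ n) (\<lambda>_. 0)" for n
  have u_Suc: "u (Suc n) = B (u n)" for n
    by (simp add: u_def)
  have B_cont: "continuous_on X (B v)" if v: "continuous_on X v" for v
    unfolding B_def
    using maps by (intro continuous_on_Max P continuous_intros g continuous_on_compose2[OF v \<sigma>]) auto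
  have u_cont: "continuous_on X (u n)" for n
    by (induction n) (simp_all add: u_Suc B_cont, simp add: u_def)
  have B_contr: "\<bar>B v x - B w x\<bar> \<le> lam * e"
    if "x \<in> X" "\<And>y. y \<in> X \<Longrightarrow> \<bar>v y - w y\<bar> \<le> e" for v w x e
    unfolding B_def
  proof (rule abs_Max_diff_le[OF P])
    fix p assume "p \<in> P"
    then have "\<sigma> p x \<in> X" using maps that(1) by auto
    then have "lam * \<bar>v (\<sigma> p x) - w (\<sigma> p x)\<bar> \<le> lam * e"
      using lam by (intro mult_left_mono that) auto
    then show "\<bar>g p x + lam * v (\<sigma> p x) - (g p x + lam * w (\<sigma> p x))\<bar> \<le> lam * e"
      using lam by (simp add: abs_mult flip: right_diff_distrib)
  qed
  have "bounded (u 1 ` X)"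
    by (intro compact_imp_bounded compact_continuous_image u_cont \<open>compact X\<close>)
  then obtain K where K: "\<And>x. x \<in> X \<Longrightarrow> \<bar>u 1 x\<bar> \<le> K"
    unfolding bounded_iff by auto
  have step: "\<bar>u (Suc n) x - u n x\<bar> \<le> lam ^ n * K" if "x \<in> X" for n x
    using that
  proof (induction n arbitrary: x)
    case 0
    then show ?case using K[of x] by (simp add: u_def)
  next
    case (Suc n)
    have "\<bar>B (u (Suc n)) x - B (u n) x\<bar> \<le> lam * (lam ^ n * K)"
      by (rule B_contr) (use Suc in auto)
    then show ?case by (simp add: u_Suc[of "Suc n"] u_Suc[of n] mult.assoc)
  qed
  define v where "v = (\<lambda>x. \<Sum>n. u (Suc n) x - u n x)"
  have "summable (\<lambda>n. lam ^ n * K)"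
    using lam by (intro summable_mult2 summable_geometric) auto
  then have "uniform_limit X (\<lambda>n x. \<Sum>i<n. u (Suc i) x - u i x) v sequentially"
    unfolding v_def using step by (intro Weierstrass_m_test) auto
  moreover have "(\<Sum>i<n. u (Suc i) x - u i x) = u n x" for n x
    by (subst sum_lessThan_telescope) (simp add: u_def)
  ultimately have lim: "uniform_limit X u v sequentially"
    by simp
  have v_cont: "continuous_on X v"
    by (rule uniform_limit_theorem[OF _ lim]) (simp_all add: u_cont)
  have "v x = B v x" if x: "x \<in> X" for x
  proof (rule LIMSEQ_unique)
    show "(\<lambda>n. u (Suc n) x) \<longlonglongrightarrow> v x"
      using tendsto_uniform_limitI[OF lim x] by (rule LIMSEQ_Suc)
    show "(\<lambda>n. u (Suc n) x) \<longlonglongrightarrow> B v x"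
    proof (rule LIMSEQ_I)
      fix r :: real assume "r > 0"
      then have "\<forall>\<^sub>F n in sequentially. \<forall>y\<in>X. dist (u n y) (v y) < r"
        by (rule uniform_limitD[OF lim])
      then obtain N where N: "\<And>n y. n \<ge> N \<Longrightarrow> y \<in> X \<Longrightarrow> \<bar>u n y - v y\<bar> < r"
        unfolding eventually_sequentially dist_real_def by blast
      have "\<bar>u (Suc n) x - B v x\<bar> < r" if "n \<ge> N" for n
      proof -
        have "\<bar>B (u n) x - B v x\<bar> \<le> lam * r"
          by (rule B_contr[OF x]) (use N[OF that] in \<open>auto intro: less_imp_le\<close>)
        also have "\<dots> < r" using lam \<open>r > 0\<close> by simp
        finally show ?thesis by (simp add: u_Suc)
      qed
      then show "\<exists>N. \<forall>n\<ge>N. norm (u (Suc n) x - B v x) < r" by auto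
    qed
  qed
  then show ?thesis
    using v_cont that unfolding B_def by blast
qed

section \<open>Measurable optimal policies\<close>

text \<open>
  Ties are broken by an enumeration of \<open>P\<close>: the least index of a maximizer depends measurably
  on the point, as each event \<open>f p x = Max \<dots>\<close> is measurable.
\<close>
lemma measurable_argmax:
  fixes f :: "'p \<Rightarrow> 'a \<Rightarrow> real"
  assumes P: "finite P" "P \<noteq> {}" and f: "\<And>p. p \<in> P \<Longrightarrow> f p \<in> borel_measurable M"
  obtains s where "s \<in> M \<rightarrow>\<^sub>M count_space P"
    and "\<And>x. x \<in> space M \<Longrightarrow> f (s x) x = Max ((\<lambda>p. f p x) ` P)"
proof -
  \<comment> \<open>The enumeration repeats elements, so that every index denotes a measurable \<open>f p\<close>.\<close>
  define e where "e = from_nat_into P"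
  have e: "e n \<in> P" for n
    unfolding e_def by (rule from_nat_into[OF P(2)])
  define m where "m x = Max ((\<lambda>p. f p x) ` P)" for x
  define k where "k x = (LEAST n. f (e n) x = m x)" for x
  have [measurable]: "m \<in> borel_measurable M"
    unfolding m_def by (intro borel_measurable_Max P f)
  have [measurable]: "f (e n) \<in> borel_measurable M" for n
    by (intro f e)
  have k: "k \<in> M \<rightarrow>\<^sub>M count_space UNIV"
    unfolding k_def by measurable
  have "(\<lambda>x. e (k x)) \<in> M \<rightarrow>\<^sub>M count_space P"
    by (rule measurable_compose[OF k]) (auto intro: e)
  moreover have "f (e (k x)) x = m x" for x
  proof -
    have "m x \<in> (\<lambda>p. f p x) ` P"
      unfolding m_def using P by (intro Max_in) auto
    then obtain p where p: "p \<in> P" "m x = f p x" by auto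
    moreover obtain n where "e n = p"
      using range_from_nat_into[OF P(2) countable_finite[OF P(1)]] p(1)
      unfolding e_def by (metis imageE)
    ultimately have "f (e n) x = m x" by simp
    then show ?thesis unfolding k_def by (rule LeastI)
  qed
  ultimately show ?thesis
    using that unfolding m_def by blast
qed

section \<open>Discounted occupation measures\<close>

text \<open>
  Condition on whether the first trial succeeds; otherwise memorylessness shifts the index.
\<close>
lemma expectation_geometric_pmf_unfold:
  fixes f :: "nat \<Rightarrow> real"
  assumes p: "0 < p" "p \<le> 1" and bound: "\<And>n. \<bar>f n\<bar> \<le> K"
  shows "measure_pmf.expectation (geometric_pmf p) f =
    p * f 0 + (1 - p) * measure_pmf.expectation (geometric_pmf p) (\<lambda>n. f (Suc n))"
proof -
  have *: "summable (\<lambda>n. (1 - p) ^ n * p * h n) \<and>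
    measure_pmf.expectation (geometric_pmf p) h = (\<Sum>n. (1 - p) ^ n * p * h n)"
    if h: "\<And>n. \<bar>h n\<bar> \<le> K" for h :: "nat \<Rightarrow> real"
  proof -
    have "integrable (geometric_pmf p) h"
      using h by (intro measure_pmf.integrable_const_bound[where B=K]) auto
    then have "integrable (count_space UNIV) (\<lambda>n. pmf (geometric_pmf p) n * h n)"
      unfolding measure_pmf_eq_density by (subst (asm) integrable_density) auto
    then have i: "integrable (count_space UNIV) (\<lambda>n. (1 - p) ^ n * p * h n)"
      using p by simp
    have "measure_pmf.expectation (geometric_pmf p) h =
      (\<integral>n. pmf (geometric_pmf p) n * h n \<partial>count_space UNIV)"
      unfolding measure_pmf_eq_density by (subst integral_density) auto
    also have "\<dots> = (\<integral>n. (1 - p) ^ n * p * h n \<partial>count_space UNIV)"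
      using p by simp
    finally show ?thesis
      using sums_integral_count_space_nat[OF i] by (simp add: sums_iff)
  qed
  have "(\<Sum>n. (1 - p) ^ n * p * f n) = p * f 0 + (\<Sum>n. (1 - p) ^ Suc n * p * f (Suc n))"
    using suminf_split_head[of "\<lambda>n. (1 - p) ^ n * p * f n"] *[OF bound] by simp
  also have "(\<Sum>n. (1 - p) ^ Suc n * p * f (Suc n)) =
      (1 - p) * (\<Sum>n. (1 - p) ^ n * p * f (Suc n))"
    using *[of "\<lambda>n. f (Suc n)"] bound by (subst suminf_mult[symmetric]) (auto simp: mult.assoc)
  finally show ?thesis
    using *[of f] *[of "\<lambda>n. f (Suc n)"] bound by simp
qed

text \<open>
  The series \<open>(1 - lam) * (\<Sum>n. lam ^ n * T\<^sup>n\<^sub>* \<nu>)\<close> is the law of the state at an independent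
  geometric time, that is the image of a product probability measure; this makes
  countable additivity and the interchange of sum and integral instances of Fubini's theorem.
  Splitting off the time \<open>0\<close> gives the recursion \<open>\<rho> = (1 - lam) \<nu> + lam T\<^sub>* \<rho>\<close>, here
  tested against bounded measurable functions.
\<close>
lemma discounted_occupation_measure:
  fixes lam :: real
  assumes \<nu>: "\<nu> \<in> space (prob_algebra M)" and T: "T \<in> M \<rightarrow>\<^sub>M M"
    and lam: "0 < lam" "lam < 1"
  obtains \<rho> where "\<rho> \<in> space (prob_algebra M)"
    and "\<And>(w :: 'a \<Rightarrow> real) K. w \<in> borel_measurable M \<Longrightarrow> (\<And>x. x \<in> space M \<Longrightarrow> \<bar>w x\<bar> \<le> K) \<Longrightarrow>
      (\<integral>x. w x \<partial>\<rho>) = (1 - lam) * (\<integral>x. w x \<partial>\<nu>) + lam * (\<integral>x. w (T x) \<partial>\<rho>)"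
proof -
  define G where "G = measure_pmf (geometric_pmf (1 - lam))"
  have sets_\<nu> [measurable_cong]: "sets \<nu> = sets M" and "prob_space \<nu>"
    using \<nu> by (auto simp: space_prob_algebra)
  have sets_G [measurable_cong]: "sets G = sets (count_space UNIV)"
    by (simp add: G_def)
  interpret \<nu>: prob_space \<nu> by fact
  interpret G: prob_space G unfolding G_def by (rule measure_pmf.prob_space_axioms)
  interpret pair_prob_space G \<nu> ..
  have sp: "space \<nu> = space M"
    by (rule sets_eq_imp_space_eq[OF sets_\<nu>])
  have Tn: "T ^^ n \<in> M \<rightarrow>\<^sub>M M" for n
    by (induction n) (simp_all add: measurable_compose[OF _ T])
  define J where "J = (\<lambda>(n, x). (T ^^ n) x)"
  have "J \<in> count_space UNIV \<Otimes>\<^sub>M M \<rightarrow>\<^sub>M M"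
    unfolding J_def by (rule measurable_pair_measure_countable1) (auto intro: Tn)
  then have J [measurable]: "J \<in> G \<Otimes>\<^sub>M \<nu> \<rightarrow>\<^sub>M M"
    by (simp cong: measurable_cong_sets add: sets_pair_measure_cong[OF sets_G sets_\<nu>])
  define \<rho> where "\<rho> = distr (G \<Otimes>\<^sub>M \<nu>) M J"
  have \<rho>: "\<rho> \<in> space (prob_algebra M)"
    unfolding space_prob_algebra \<rho>_def by (auto intro: prob_space_distr J)
  have int: "(\<integral>x. w x \<partial>\<rho>) = (\<integral>n. (\<integral>x. w ((T ^^ n) x) \<partial>\<nu>) \<partial>G)"
    if w [measurable]: "w \<in> borel_measurable M" and K: "\<And>x. x \<in> space M \<Longrightarrow> \<bar>w x\<bar> \<le> K"
    for w :: "'a \<Rightarrow> real" and K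
  proof -
    have "integrable (G \<Otimes>\<^sub>M \<nu>) (\<lambda>z. w (J z))"
      using measurable_space[OF J] K
      by (intro P.integrable_const_bound[where B=K]) auto
    from integral_fst'[OF this]
    have "(\<integral>z. w (J z) \<partial>(G \<Otimes>\<^sub>M \<nu>)) = (\<integral>n. (\<integral>x. w (J (n, x)) \<partial>\<nu>) \<partial>G)"
      by (rule sym)
    then show ?thesis
      unfolding \<rho>_def integral_distr[OF J w] by (simp only: J_def prod.case)
  qed
  show ?thesis
  proof (rule that[OF \<rho>])
    fix w :: "'a \<Rightarrow> real" and K
    assume w [measurable]: "w \<in> borel_measurable M" and K: "\<And>x. x \<in> space M \<Longrightarrow> \<bar>w x\<bar> \<le> K"
    define S where "S n = (\<integral>x. w ((T ^^ n) x) \<partial>\<nu>)" for n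
    have wT: "(\<lambda>x. w (T x)) \<in> borel_measurable M"
      using T w by (rule measurable_compose)
    have "\<bar>S n\<bar> \<le> K" for n
    proof -
      have meas: "(\<lambda>x. w ((T ^^ n) x)) \<in> borel_measurable \<nu>"
        using measurable_compose[OF Tn w] by (simp add: measurable_cong_sets[OF sets_\<nu> refl])
      have b: "\<bar>w ((T ^^ n) x)\<bar> \<le> K" if "x \<in> space \<nu>" for x
        using measurable_space[OF Tn[of n], of x] that K by (simp add: sp)
      have i: "integrable \<nu> (\<lambda>x. w ((T ^^ n) x))"
        using b meas by (intro \<nu>.integrable_const_bound[where B=K]) auto
      have "\<bar>S n\<bar> \<le> (\<integral>x. \<bar>w ((T ^^ n) x)\<bar> \<partial>\<nu>)"
        unfolding S_def by (rule integral_abs_bound)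
      also have "\<dots> \<le> K"
        using b i by (intro \<nu>.integral_le_const) auto
      finally show ?thesis .
    qed
    then have "(\<integral>n. S n \<partial>G) = (1 - lam) * S 0 + lam * (\<integral>n. S (Suc n) \<partial>G)"
      unfolding G_def using lam by (subst expectation_geometric_pmf_unfold[where K=K]) auto
    moreover have "(\<integral>x. w x \<partial>\<rho>) = (\<integral>n. S n \<partial>G)"
      unfolding S_def by (rule int[OF w K])
    moreover have "(\<integral>x. w (T x) \<partial>\<rho>) = (\<integral>n. S (Suc n) \<partial>G)"
      unfolding S_def using int[OF wT K] measurable_space[OF T] by simp
    ultimately show "(\<integral>x. w x \<partial>\<rho>) = (1 - lam) * (\<integral>x. w x \<partial>\<nu>) + lam * (\<integral>x. w (T x) \<partial>\<rho>)"
      by (simp add: S_def)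
  qed
qed

section \<open>Integration over the phase space\<close>

lemma space_borel_on [simp]: "space (borel_on X) = X"
  by (simp add: borel_on_def space_restrict_space)

lemma space_phase_space [simp]: "space (phase_space X C I) = X \<times> C \<times> I"
  by (simp add: phase_space_def space_pair_measure)

lemma measurable_phase_space:
  fixes F :: "'x::metric_space \<times> 'c \<times> 'i \<Rightarrow> real"
  assumes "finite C" "finite I"
    and F: "\<And>c a. c \<in> C \<Longrightarrow> a \<in> I \<Longrightarrow> continuous_on X (\<lambda>x. F (x, c, a))"
  shows "F \<in> borel_measurable (phase_space X C I)"
proof -
  have "(\<lambda>x. F (x, p)) \<in> borel_measurable (borel_on X)" if "p \<in> C \<times> I" for p
    using that F unfolding borel_on_def
    by (cases p) (auto intro!: borel_measurable_continuous_on_restrict)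
  then have "(\<lambda>(p, x). F (x, p)) \<in> borel_measurable (count_space (C \<times> I) \<Otimes>\<^sub>M borel_on X)"
    using assms(1,2) by (intro measurable_pair_measure_countable1) (auto intro: countable_finite)
  from measurable_pair_swap[OF this] show ?thesis
    by (simp add: phase_space_def pair_measure_count_space assms(1,2) split_beta)
qed

lemma integrable_phase_space:
  fixes F :: "'x::metric_space \<times> 'c \<times> 'i \<Rightarrow> real"
  assumes "compact X" "finite C" "finite I"
    and F: "\<And>c a. c \<in> C \<Longrightarrow> a \<in> I \<Longrightarrow> continuous_on X (\<lambda>x. F (x, c, a))"
    and \<mu>: "\<mu> \<in> space (prob_algebra (phase_space X C I))"
  shows "integrable \<mu> F"
proof -
  have sets: "sets \<mu> = sets (phase_space X C I)" and "prob_space \<mu>"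
    using \<mu> by (auto simp: space_prob_algebra)
  interpret prob_space \<mu> by fact
  have "bounded (\<Union>(c, a)\<in>C \<times> I. (\<lambda>x. F (x, c, a)) ` X)"
    using assms by (auto intro!: bounded_UN compact_imp_bounded compact_continuous_image)
  then obtain K where K: "\<And>x c a. x \<in> X \<Longrightarrow> c \<in> C \<Longrightarrow> a \<in> I \<Longrightarrow> \<bar>F (x, c, a)\<bar> \<le> K"
    unfolding bounded_iff by force
  have "space \<mu> = X \<times> C \<times> I"
    using sets_eq_imp_space_eq[OF sets] by simp
  then show ?thesis
    using K measurable_phase_space[OF assms(2,3) F]
    by (intro integrable_const_bound[where B=K]) (auto simp: measurable_cong_sets[OF sets refl])
qed

text \<open>
  The holonomic constraint turns \<open>(1 - lam) * \<integral>x. w x \<partial>\<nu>\<close> into minus the integral of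
  \<open>disc_diff\<close>, so the reward minus this number is the \<open>\<mu>\<close>-average of the function under the
  supremum.
\<close>
lemma reward_le_dual_value:
  fixes X :: "'x::metric_space set"
  assumes "compact X" "finite C" "finite I"
    and \<tau>: "\<And>a. a \<in> I \<Longrightarrow> continuous_on X (\<tau> a)" "\<And>a. a \<in> I \<Longrightarrow> \<tau> a \<in> X \<rightarrow> X"
    and A: "\<And>c. c \<in> C \<Longrightarrow> continuous_on X (A c)"
    and \<mu>: "\<mu> \<in> disc_holonomic X C I \<tau> lam \<nu>" and w: "w \<in> C0 X"
  shows "ereal (reward A \<tau> \<mu>) \<le> ereal ((1 - lam) * (\<integral>x. w x \<partial>\<nu>)) +
    (SUP (x, c, a)\<in>X \<times> C \<times> I. ereal (disc_diff \<tau> lam w x a + A c (\<tau> a x)))"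
    (is "_ \<le> ereal ?W + ?S")
proof -
  have P\<mu>: "\<mu> \<in> space (prob_algebra (phase_space X C I))"
    and hol: "(\<integral>(x, c, a). disc_diff \<tau> lam w x a \<partial>\<mu>) = - ?W"
    using \<mu> w unfolding disc_holonomic_def by (simp_all add: algebra_simps)
  have sets: "sets \<mu> = sets (phase_space X C I)" and "prob_space \<mu>"
    using P\<mu> by (auto simp: space_prob_algebra)
  interpret prob_space \<mu> by fact
  have space: "space \<mu> = X \<times> C \<times> I"
    using sets_eq_imp_space_eq[OF sets] by simp
  have comp: "continuous_on X (\<lambda>x. h (\<tau> a x))" if "continuous_on X h" "a \<in> I" for h :: "'x \<Rightarrow> real" and a
    using that \<tau> by (intro continuous_on_compose2[OF that(1) \<tau>(1)]) auto
  have i1: "integrable \<mu> (\<lambda>(x, c, a). disc_diff \<tau> lam w x a)"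
    using w unfolding C0_def disc_diff_def
    by (intro integrable_phase_space[OF assms(1-3) _ P\<mu>]) (auto intro!: continuous_intros comp)
  have i2: "integrable \<mu> (\<lambda>(x, c, a). A c (\<tau> a x))"
    by (intro integrable_phase_space[OF assms(1-3) _ P\<mu>]) (auto intro!: comp A)
  have le: "ereal (disc_diff \<tau> lam w x a + A c (\<tau> a x)) \<le> ?S"
    if "x \<in> X" "c \<in> C" "a \<in> I" for x c a
    using that by (intro SUP_upper2[of "(x, c, a)"]) auto
  obtain x c a where "(x, c, a) \<in> X \<times> C \<times> I"
    using not_empty space by auto
  then have "?S \<noteq> - \<infinity>"
    using le[of x c a] by auto
  then show ?thesis
  proof (cases ?S)
    case (real s)
    have "reward A \<tau> \<mu> - ?W = (\<integral>z. (\<lambda>(x, c, a). disc_diff \<tau> lam w x a) z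
        + (\<lambda>(x, c, a). A c (\<tau> a x)) z \<partial>\<mu>)"
      by (subst Bochner_Integration.integral_add[OF i1 i2]) (simp add: hol reward_def)
    also have "\<dots> \<le> s"
      using le real by (intro integral_le_const Bochner_Integration.integrable_add i1 i2) (auto simp: space)
    finally show ?thesis by (simp add: real)
  qed auto
qed

section \<open>Duality\<close>

theorem theorem4p2:
  fixes X :: "'x::metric_space set" and C :: "'c set" and I :: "'i set"
    and \<tau> :: "'i \<Rightarrow> 'x \<Rightarrow> 'x" and A :: "'c \<Rightarrow> 'x \<Rightarrow> real"
    and lam :: real and \<nu> :: "'x measure"
  assumes "compact X"
    and "finite C" and "C \<noteq> {}"
    and "finite I" and "I \<noteq> {}"
    and "contractive_IFS X I \<tau>"
    and "\<forall>c\<in>C. \<exists>L. L-lipschitz_on X (A c)"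
    and "0 < lam" and "lam < 1"
    and "\<nu> \<in> space (prob_algebra (borel_on X))"
  shows "\<exists>\<mu>\<in>disc_holonomic X C I \<tau> lam \<nu>.
           (\<forall>\<mu>'\<in>disc_holonomic X C I \<tau> lam \<nu>. reward A \<tau> \<mu>' \<le> reward A \<tau> \<mu>) \<and>
           max_value X C I \<tau> A lam \<nu> = ereal (reward A \<tau> \<mu>) \<and>
           (INF w\<in>C0 X. ereal ((1 - lam) * (\<integral>x. w x \<partial>\<nu>)) +
              (SUP (x, c, a)\<in>X \<times> C \<times> I. ereal (disc_diff \<tau> lam w x a + A c (\<tau> a x))))
             = ereal (reward A \<tau> \<mu>)"
proof -
  let ?D = "\<lambda>w. ereal ((1 - lam) * (\<integral>x. w x \<partial>\<nu>)) +
    (SUP (x, c, a)\<in>X \<times> C \<times> I. ereal (disc_diff \<tau> lam w x a + A c (\<tau> a x)))"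
  have \<tau>_maps: "\<tau> a \<in> X \<rightarrow> X" and \<tau>_cont: "continuous_on X (\<tau> a)" if "a \<in> I" for a
    using assms(6) that unfolding contractive_IFS_def by (auto intro: lipschitz_on_continuous_on)
  have \<tau>_in: "\<tau> a x \<in> X" if "a \<in> I" "x \<in> X" for a x
    using \<tau>_maps that by blast
  have A_cont: "continuous_on X (A c)" if "c \<in> C" for c
    using assms(7) that by (auto intro: lipschitz_on_continuous_on)
  have comp: "continuous_on X (\<lambda>x. h (\<tau> a x))"
    if "continuous_on X h" "a \<in> I" for h :: "'x \<Rightarrow> real" and a
    using that \<tau>_maps by (intro continuous_on_compose2[OF that(1) \<tau>_cont]) auto
  let ?P = "C \<times> I"
  have P: "finite ?P" "?P \<noteq> {}"
    using assms(2-5) by auto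
  obtain v where v_cont: "continuous_on X v" and
    v: "\<And>x. x \<in> X \<Longrightarrow> v x = Max ((\<lambda>p. A (fst p) (\<tau> (snd p) x) + lam * v (\<tau> (snd p) x)) ` ?P)"
    by (rule bellman_solution[OF assms(1) P assms(8,9),
          where g = "\<lambda>p x. A (fst p) (\<tau> (snd p) x)" and \<sigma> = "\<lambda>p. \<tau> (snd p)"])
      (use \<tau>_in \<tau>_cont A_cont comp in auto)
  define q where "q p x = A (fst p) (\<tau> (snd p) x) + lam * v (\<tau> (snd p) x)" for p x
  have v: "v x = Max ((\<lambda>p. q p x) ` ?P)" if "x \<in> X" for x
    using v[OF that] by (simp add: q_def)
  have q_le: "q (c, a) x \<le> v x" if "x \<in> X" "c \<in> C" "a \<in> I" for x c a
    unfolding v[OF that(1)] using that P by (intro Max_ge) auto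
  have "q p \<in> borel_measurable (borel_on X)" if "p \<in> ?P" for p
    unfolding q_def borel_on_def using that v_cont A_cont
    by (intro borel_measurable_continuous_on_restrict continuous_intros comp) auto
  then obtain s where s: "s \<in> borel_on X \<rightarrow>\<^sub>M count_space ?P"
    and s_max: "\<And>x. x \<in> X \<Longrightarrow> q (s x) x = v x"
    by (rule measurable_argmax[OF P, of q "borel_on X"]) (simp_all add: v)
  have s_in: "s x \<in> ?P" if "x \<in> X" for x
    using measurable_space[OF s] that by simp
  have graph: "(\<lambda>x. (x, s x)) \<in> borel_on X \<rightarrow>\<^sub>M phase_space X C I"
    unfolding phase_space_def using s assms(2,4) by (simp add: pair_measure_count_space)
  define T where "T x = \<tau> (snd (s x)) x" for x
  have "(\<lambda>x. \<tau> a x) \<in> borel_on X \<rightarrow>\<^sub>M borel_on X" if "a \<in> I" for a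
    unfolding borel_on_def using \<tau>_cont[OF that] \<tau>_maps[OF that]
    by (intro measurable_restrict_space2 borel_measurable_continuous_on_restrict)
      (auto simp: space_restrict_space)
  \<comment> \<open>\<open>T\<close> is glued from finitely many continuous maps along the measurable level sets of \<open>s\<close>.\<close>
  then have T: "T \<in> borel_on X \<rightarrow>\<^sub>M borel_on X"
    unfolding T_def
    by (intro measurable_compose_countable'[where f="\<lambda>p. \<tau> (snd p)" and g=s and I="?P"])
      (auto intro!: s countable_finite P(1))
  obtain \<rho> where \<rho>: "\<rho> \<in> space (prob_algebra (borel_on X))"
    and \<rho>_inv: "\<And>(w :: 'x \<Rightarrow> real) K. w \<in> borel_measurable (borel_on X) \<Longrightarrow>
      (\<And>x. x \<in> space (borel_on X) \<Longrightarrow> \<bar>w x\<bar> \<le> K) \<Longrightarrow>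
      (\<integral>x. w x \<partial>\<rho>) = (1 - lam) * (\<integral>x. w x \<partial>\<nu>) + lam * (\<integral>x. w (T x) \<partial>\<rho>)"
    using discounted_occupation_measure[OF assms(10) T assms(8,9)] by blast
  have sets_\<rho>: "sets \<rho> = sets (borel_on X)" and "prob_space \<rho>"
    using \<rho> by (auto simp: space_prob_algebra)
  interpret \<rho>: prob_space \<rho> by fact
  have space_\<rho>: "space \<rho> = X"
    using sets_eq_imp_space_eq[OF sets_\<rho>] by simp
  have graph_\<rho>: "(\<lambda>x. (x, s x)) \<in> \<rho> \<rightarrow>\<^sub>M phase_space X C I"
    using graph by (simp add: measurable_cong_sets[OF sets_\<rho> refl])
  have balance: "(\<integral>x. lam * w (T x) - w x \<partial>\<rho>) = - (1 - lam) * (\<integral>x. w x \<partial>\<nu>)"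
    if w: "continuous_on X w" for w :: "'x \<Rightarrow> real"
  proof -
    have "bounded (w ` X)"
      by (intro compact_imp_bounded compact_continuous_image w assms(1))
    then obtain K where K: "\<And>x. x \<in> X \<Longrightarrow> \<bar>w x\<bar> \<le> K"
      unfolding bounded_iff by auto
    have wm: "w \<in> borel_measurable (borel_on X)"
      unfolding borel_on_def by (rule borel_measurable_continuous_on_restrict[OF w])
    have wTm: "(\<lambda>x. w (T x)) \<in> borel_measurable (borel_on X)"
      by (rule measurable_compose[OF T wm])
    have "integrable \<rho> w" "integrable \<rho> (\<lambda>x. w (T x))"
      using K wm wTm measurable_space[OF T]
      by (auto intro!: \<rho>.integrable_const_bound[where B=K]
          simp: space_\<rho> measurable_cong_sets[OF sets_\<rho> refl])
    then have "(\<integral>x. lam * w (T x) - w x \<partial>\<rho>) = lam * (\<integral>x. w (T x) \<partial>\<rho>) - (\<integral>x. w x \<partial>\<rho>)"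
      by (subst Bochner_Integration.integral_diff) auto
    then show ?thesis
      using \<rho>_inv[OF wm, of K] K by (simp add: algebra_simps)
  qed
  define \<mu> where "\<mu> = distr \<rho> (phase_space X C I) (\<lambda>x. (x, s x))"
  have \<mu>_int: "(\<integral>z. F z \<partial>\<mu>) = (\<integral>x. F (x, s x) \<partial>\<rho>)"
    if "\<And>c a. c \<in> C \<Longrightarrow> a \<in> I \<Longrightarrow> continuous_on X (\<lambda>x. F (x, c, a))" for F :: "_ \<Rightarrow> real"
    unfolding \<mu>_def by (intro integral_distr graph_\<rho> measurable_phase_space assms that)
  have \<mu>: "\<mu> \<in> disc_holonomic X C I \<tau> lam \<nu>"
    unfolding disc_holonomic_def
  proof (intro CollectI conjI ballI)
    show "\<mu> \<in> space (prob_algebra (phase_space X C I))"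
      unfolding \<mu>_def space_prob_algebra by (simp add: \<rho>.prob_space_distr[OF graph_\<rho>])
    fix w assume "w \<in> C0 X"
    then have w: "continuous_on X w" by (simp add: C0_def)
    have "(\<integral>(x, c, a). disc_diff \<tau> lam w x a \<partial>\<mu>) = (\<integral>x. lam * w (T x) - w x \<partial>\<rho>)"
      by (subst \<mu>_int) (auto simp: disc_diff_def T_def split_beta intro!: continuous_intros w comp)
    then show "(\<integral>(x, c, a). disc_diff \<tau> lam w x a \<partial>\<mu>) = - (1 - lam) * (\<integral>x. w x \<partial>\<nu>)"
      by (simp only: balance[OF w])
  qed
  have reward_\<mu>: "reward A \<tau> \<mu> = (1 - lam) * (\<integral>x. v x \<partial>\<nu>)"
  proof -
    have "reward A \<tau> \<mu> = (\<integral>x. A (fst (s x)) (T x) \<partial>\<rho>)"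
      unfolding reward_def by (subst \<mu>_int) (auto simp: T_def split_beta intro!: A_cont comp)
    also have "\<dots> = (\<integral>x. - (lam * v (T x) - v x) \<partial>\<rho>)"
    proof (rule Bochner_Integration.integral_cong[OF refl])
      fix x assume "x \<in> space \<rho>"
      then have "q (s x) x = v x"
        by (simp add: space_\<rho> s_max)
      then show "A (fst (s x)) (T x) = - (lam * v (T x) - v x)"
        by (simp add: q_def T_def)
    qed
    also have "\<dots> = (1 - lam) * (\<integral>x. v x \<partial>\<nu>)"
      by (simp only: Bochner_Integration.integral_minus balance[OF v_cont] mult_minus_left minus_minus)
    finally show ?thesis .
  qed
  have weak: "ereal (reward A \<tau> \<mu>') \<le> ?D w"
    if "\<mu>' \<in> disc_holonomic X C I \<tau> lam \<nu>" "w \<in> C0 X" for \<mu>' w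
    by (rule reward_le_dual_value) (use assms \<tau>_cont \<tau>_maps A_cont that in auto)
  have v_C0: "v \<in> C0 X"
    using v_cont by (simp add: C0_def)
  have "(SUP (x, c, a)\<in>X \<times> C \<times> I. ereal (disc_diff \<tau> lam v x a + A c (\<tau> a x))) \<le> 0"
  proof (intro SUP_least, clarsimp)
    fix x c a assume "x \<in> X" "c \<in> C" "a \<in> I"
    then show "disc_diff \<tau> lam v x a + A c (\<tau> a x) \<le> 0"
      using q_le[of x c a] by (simp add: disc_diff_def q_def)
  qed
  then have "?D v \<le> ereal ((1 - lam) * (\<integral>x. v x \<partial>\<nu>)) + 0"
    by (rule add_left_mono)
  then have strong: "?D v \<le> ereal (reward A \<tau> \<mu>)"
    by (simp only: reward_\<mu> add_0_right)
  have opt: "ereal (reward A \<tau> \<mu>') \<le> ereal (reward A \<tau> \<mu>)"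
    if "\<mu>' \<in> disc_holonomic X C I \<tau> lam \<nu>" for \<mu>'
    using weak[OF that v_C0] strong by (rule order.trans)
  show ?thesis
  proof (intro bexI[OF _ \<mu>] conjI ballI)
    show "reward A \<tau> \<mu>' \<le> reward A \<tau> \<mu>" if "\<mu>' \<in> disc_holonomic X C I \<tau> lam \<nu>" for \<mu>'
      using opt[OF that] by simp
    show "max_value X C I \<tau> A lam \<nu> = ereal (reward A \<tau> \<mu>)"
      unfolding max_value_def by (intro antisym SUP_least SUP_upper opt \<mu>)
    show "(INF w\<in>C0 X. ?D w) = ereal (reward A \<tau> \<mu>)"
    proof (rule antisym)
      show "(INF w\<in>C0 X. ?D w) \<le> ereal (reward A \<tau> \<mu>)"
        using INF_lower[OF v_C0, of ?D] strong by (rule order.trans)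
      show "ereal (reward A \<tau> \<mu>) \<le> (INF w\<in>C0 X. ?D w)"
        by (rule INF_greatest) (rule weak[OF \<mu>])
    qed
  qed
qed

end
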